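(* Let $\mathcal U\subset\mathbb C$ be an open domain and assume that $u\in C^\infty(\mathcal U)$ (real-valued) is a solution to $$\operatorname{div}\,\nabla\sigma(\nabla u(z))=w(z),\qquad z\in\mathcal U,$$ where $\nabla u(\mathcal U)\subset N^\circ$, $\sigma$ is the surface tension on the triangle $N$ given in the context, and $w(z)=\ln(q)\,\dfrac{\kappa^2q^{-S+2y-x}+1}{\kappa^2q^{-S+2y-x}-1}$ for $z=x+iy$. Then the function $$f(z)=\overline{(I+\nabla\sigma)(\nabla u(z))}$$ solves the inhomogeneous $\mathbb C$-quasilinear Beltrami equation $$f_{\bar z}(z)=\mathcal H_\sigma'(f(z))\,f_z(z)+w(z),\qquad z\in\mathcal U.$$
   Context: $\mathbb R^2$ is identified with $\mathbb C$; gradients are viewed as complex numbers ($\nabla u=u_x+iu_y$, $\nabla\sigma=\sigma_s+i\sigma_t$), $I$ is the identity map, and $f_z=\frac12(f_x-if_y)$, $f_{\bar z}=\frac12(f_x+if_y)$. $N\subset\mathbb C$ is the closed triangle with vertices $0,1,i$, $N^\circ$ its interior, and for $s+it\in N$ $$\sigma(s,t)=-\frac1{\pi^2}\big(\Lambda(\pi s)+\Lambda(\pi t)+\Lambda(\pi(1-s-t))\big),\qquad \Lambda(\theta)=-\int_0^\theta\log|2\sin x|\,dx .$$ Define $$\mathcal H_\sigma(z)=(I-\nabla\sigma)\circ(I+\nabla\sigma)^{-1}(\bar z),\qquad z\in\mathrm{Dom}(\mathcal H_\sigma)=\{z\in\mathbb C:\bar z\in(I+\nabla\sigma)(N^\circ)\};$$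 it is known that $\mathcal H_\sigma$ is holomorphic on its domain, and $\mathcal H_\sigma'=\partial_z\mathcal H_\sigma$. $S,q,\kappa$ are parameters for which $w$ is real-valued, and $\mathcal U$ is disjoint from the set where the denominator of $w$ vanishes (so $w\in C^\infty(\mathcal U)$). *)

theory Defs
  imports "HOL-Complex_Analysis.Complex_Analysis"
begin

definition partial_x :: "(complex \<Rightarrow> 'a::real_normed_vector) \<Rightarrow> complex \<Rightarrow> 'a" where
  "partial_x f z = vector_derivative (\<lambda>h. f (z + of_real h)) (at 0)"

definition partial_y :: "(complex \<Rightarrow> 'a::real_normed_vector) \<Rightarrow> complex \<Rightarrow> 'a" where
  "partial_y f z = vector_derivative (\<lambda>h. f (z + \<i> * of_real h)) (at 0)"

definition gradient :: "(complex \<Rightarrow> real) \<Rightarrow> complex \<Rightarrow> complex" where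
  "gradient f z = Complex (partial_x f z) (partial_y f z)"

definition divergence :: "(complex \<Rightarrow> complex) \<Rightarrow> complex \<Rightarrow> real" where
  "divergence F z = partial_x (\<lambda>p. Re (F p)) z + partial_y (\<lambda>p. Im (F p)) z"

definition wirtinger_z :: "(complex \<Rightarrow> complex) \<Rightarrow> complex \<Rightarrow> complex" where
  "wirtinger_z f z = (partial_x f z - \<i> * partial_y f z) / 2"

definition wirtinger_zbar :: "(complex \<Rightarrow> complex) \<Rightarrow> complex \<Rightarrow> complex" where
  "wirtinger_zbar f z = (partial_x f z + \<i> * partial_y f z) / 2"

text \<open>Real smoothness on an open set \<open>U\<close>. Differentiability is Frechet
  differentiability over the reals, so \<open>Ck_on k f U\<close> says that \<open>f\<close> is of class
  \<open>C\<close>-\<open>k\<close> on \<open>U\<close>; it is only meant for open \<open>U\<close>.\<close>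

primrec Ck_on :: "nat \<Rightarrow> (complex \<Rightarrow> real) \<Rightarrow> complex set \<Rightarrow> bool" where
  "Ck_on 0 f U \<longleftrightarrow> continuous_on U f"
| "Ck_on (Suc k) f U \<longleftrightarrow>
     f differentiable_on U \<and> Ck_on k (partial_x f) U \<and> Ck_on k (partial_y f) U"

definition smooth_on :: "(complex \<Rightarrow> real) \<Rightarrow> complex set \<Rightarrow> bool" where
  "smooth_on f U \<longleftrightarrow> (\<forall>k. Ck_on k f U)"

definition triangle_N :: "complex set" where
  "triangle_N = convex hull {0, 1, \<i>}"

definition Lobachevsky :: "real \<Rightarrow> real" where
  "Lobachevsky \<theta> = - (LBINT x=ereal 0..ereal \<theta>. ln \<bar>2 * sin x\<bar>)"

text \<open>The surface tension is a function on \<open>triangle_N\<close>; its values elsewhere are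
  irrelevant, since its gradient is only used at interior points.\<close>

definition surface_tension :: "complex \<Rightarrow> real" where
  "surface_tension p =
     - (1 / pi\<^sup>2) * (Lobachevsky (pi * Re p) + Lobachevsky (pi * Im p)
                     + Lobachevsky (pi * (1 - Re p - Im p)))"

definition I_plus_grad :: "complex \<Rightarrow> complex" where
  "I_plus_grad p = p + gradient surface_tension p"

definition I_minus_grad :: "complex \<Rightarrow> complex" where
  "I_minus_grad p = p - gradient surface_tension p"

text \<open>The inverse of \<open>I_plus_grad\<close> is that of its restriction to the interior of the
  triangle, so \<open>H_sigma\<close> is meaningful on
  \<open>{z. cnj z \<in> I_plus_grad ` interior triangle_N}\<close> only.\<close>

definition H_sigma :: "complex \<Rightarrow> complex" where
  "H_sigma z = (I_minus_grad \<circ> inv_into (interior triangle_N) I_plus_grad) (cnj z)"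

text \<open>The parameters may be complex (e.g. \<open>q\<close> and \<open>\<kappa>\<close> on the unit circle), in which case
  logarithm and power are the principal ones.\<close>

definition w_exponential :: "complex \<Rightarrow> complex \<Rightarrow> complex \<Rightarrow> complex \<Rightarrow> complex" where
  "w_exponential S q \<kappa> z = \<kappa>\<^sup>2 * q powr (- S + of_real (2 * Im z - Re z))"

definition w_source :: "complex \<Rightarrow> complex \<Rightarrow> complex \<Rightarrow> complex \<Rightarrow> complex" where
  "w_source S q \<kappa> z = ln q * ((w_exponential S q \<kappa> z + 1) / (w_exponential S q \<kappa> z - 1))"

end

theory Submission
  imports Defs
begin

text \<open>Put \<open>p = \<nabla>u\<close> and \<open>g = \<nabla>\<sigma>(\<nabla>u)\<close>, so that the conjugate of \<open>f\<close> is \<open>p + g\<close> and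
  \<open>H\<^sub>\<sigma>(f) = p - g\<close>. As \<open>H\<^sub>\<sigma>\<close> is holomorphic, \<open>H\<^sub>\<sigma>'(f) f\<^sub>z = (p - g)\<^sub>z\<close>. Here \<open>p\<^sub>z\<close> is real
  by symmetry of the second derivatives of \<open>u\<close>, so subtracting from \<open>f\<^bsub>zbar\<^esub>\<close>, the conjugate
  of \<open>(p + g)\<^sub>z\<close>, leaves \<open>2 Re g\<^sub>z\<close>, which is the divergence of \<open>g\<close>. Holomorphy of \<open>H\<^sub>\<sigma>\<close> comes
  from the Monge--Ampere equation \<open>det D\<^sup>2\<sigma> = 1\<close>, the addition theorem of the cotangent.\<close>

section \<open>Partial derivatives\<close>

lemma partial_x_eq:
  assumes "(f has_derivative f') (at z)"
  shows "partial_x f z = f' 1"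
proof -
  have "((\<lambda>h::real. z + of_real h) has_vector_derivative 1) (at 0)"
    by (auto intro!: derivative_eq_intros)
  moreover have "(f has_derivative f') (at (z + of_real 0))"
    using assms by simp
  ultimately have "(f \<circ> (\<lambda>h. z + of_real h) has_vector_derivative f' 1) (at 0)"
    by (rule vector_derivative_diff_chain_within[OF _ has_derivative_at_withinI])
  then show ?thesis
    by (auto simp: partial_x_def o_def intro: vector_derivative_at)
qed

lemma partial_y_eq:
  assumes "(f has_derivative f') (at z)"
  shows "partial_y f z = f' \<i>"
proof -
  have "((\<lambda>h::real. z + \<i> * of_real h) has_vector_derivative \<i>) (at 0)"
    by (auto intro!: derivative_eq_intros)
  moreover have "(f has_derivative f') (at (z + \<i> * of_real 0))"
    using assms by simp
  ultimately have "(f \<circ> (\<lambda>h. z + \<i> * of_real h) has_vector_derivative f' \<i>) (at 0)"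
    by (rule vector_derivative_diff_chain_within[OF _ has_derivative_at_withinI])
  then show ?thesis
    by (auto simp: partial_y_def o_def intro: vector_derivative_at)
qed

lemma has_derivative_Complex:
  assumes "(f has_derivative f') F" "(g has_derivative g') F"
  shows "((\<lambda>x. Complex (f x) (g x)) has_derivative (\<lambda>h. Complex (f' h) (g' h))) F"
  unfolding Complex_eq using assms by (auto intro!: derivative_eq_intros)

section \<open>Symmetry of second derivatives\<close>

text \<open>The mean value theorem is applied along \<open>a\<close> to the increment of
  \<open>f\<close> in direction \<open>b\<close>, then along \<open>b\<close> to \<open>fa\<close>.
  As the second difference is symmetric in \<open>a\<close> and \<open>b\<close>, using both orders
  compares the two mixed derivatives.\<close>

lemma second_difference_mvt:
  fixes f fa fab :: "'a::real_normed_vector \<Rightarrow> real"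
  assumes "0 < t"
    and S: "\<And>r s. 0 \<le> r \<Longrightarrow> r \<le> t \<Longrightarrow> 0 \<le> s \<Longrightarrow> s \<le> t \<Longrightarrow> z + r *\<^sub>R a + s *\<^sub>R b \<in> S"
    and fa: "\<And>p. p \<in> S \<Longrightarrow> ((\<lambda>h. f (p + h *\<^sub>R a)) has_real_derivative fa p) (at 0)"
    and fab: "\<And>p. p \<in> S \<Longrightarrow> ((\<lambda>h. fa (p + h *\<^sub>R b)) has_real_derivative fab p) (at 0)"
  obtains r s where "0 < r" "r < t" "0 < s" "s < t"
    "f (z + t *\<^sub>R a + t *\<^sub>R b) - f (z + t *\<^sub>R a) - f (z + t *\<^sub>R b) + f z
      = t\<^sup>2 * fab (z + r *\<^sub>R a + s *\<^sub>R b)"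
proof -
  have da: "((\<lambda>r. f (z + r *\<^sub>R a + s *\<^sub>R b)) has_real_derivative fa (z + r *\<^sub>R a + s *\<^sub>R b)) (at r)"
    if "0 \<le> r" "r \<le> t" "0 \<le> s" "s \<le> t" for r s
    using fa[OF S[OF that]] DERIV_shift[of "\<lambda>r. f (z + r *\<^sub>R a + s *\<^sub>R b)" "fa (z + r *\<^sub>R a + s *\<^sub>R b)" 0 r]
    by (simp add: algebra_simps)
  have db: "((\<lambda>s. fa (z + r *\<^sub>R a + s *\<^sub>R b)) has_real_derivative fab (z + r *\<^sub>R a + s *\<^sub>R b)) (at s)"
    if "0 \<le> r" "r \<le> t" "0 \<le> s" "s \<le> t" for r s
    using fab[OF S[OF that]] DERIV_shift[of "\<lambda>s. fa (z + r *\<^sub>R a + s *\<^sub>R b)" "fab (z + r *\<^sub>R a + s *\<^sub>R b)" 0 s]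
    by (simp add: algebra_simps)
  let ?F = "\<lambda>r. f (z + r *\<^sub>R a + t *\<^sub>R b) - f (z + r *\<^sub>R a + 0 *\<^sub>R b)"
  have "\<exists>r>0. r < t \<and> ?F t - ?F 0 = (t - 0) * (fa (z + r *\<^sub>R a + t *\<^sub>R b) - fa (z + r *\<^sub>R a + 0 *\<^sub>R b))"
    by (rule MVT2[OF \<open>0 < t\<close>], rule DERIV_diff[OF da da]) (use \<open>0 < t\<close> in auto)
  then obtain r where r: "0 < r" "r < t"
    "?F t - ?F 0 = (t - 0) * (fa (z + r *\<^sub>R a + t *\<^sub>R b) - fa (z + r *\<^sub>R a + 0 *\<^sub>R b))"
    by blast
  have "\<exists>s>0. s < t \<and> fa (z + r *\<^sub>R a + t *\<^sub>R b) - fa (z + r *\<^sub>R a + 0 *\<^sub>R b)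
      = (t - 0) * fab (z + r *\<^sub>R a + s *\<^sub>R b)"
    by (rule MVT2[OF \<open>0 < t\<close>], rule db) (use r in auto)
  then obtain s where s: "0 < s" "s < t"
    "fa (z + r *\<^sub>R a + t *\<^sub>R b) - fa (z + r *\<^sub>R a + 0 *\<^sub>R b) = (t - 0) * fab (z + r *\<^sub>R a + s *\<^sub>R b)"
    by blast
  show ?thesis
    by (rule that[OF r(1,2) s(1,2)]) (use r(3)[unfolded s(3)] in \<open>simp add: power2_eq_square\<close>)
qed

lemma partial_x_derivative:
  fixes f :: "complex \<Rightarrow> real"
  assumes "f differentiable (at p)"
  shows "((\<lambda>h. f (p + h *\<^sub>R 1)) has_real_derivative partial_x f p) (at 0)"
proof -
  obtain f' where f': "(f has_derivative f') (at p)"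
    using assms by (auto simp: differentiable_def)
  have "((\<lambda>h. f (p + h *\<^sub>R 1)) has_derivative (\<lambda>h. f' (h *\<^sub>R 1))) (at 0)"
    by (rule has_derivative_compose[where g = f and x = 0]) (use f' in \<open>auto intro!: derivative_eq_intros\<close>)
  then show ?thesis
    unfolding has_field_derivative_def linear_cmul[OF has_derivative_linear[OF f']] partial_x_eq[OF f']
    by (simp add: mult_commute_abs)
qed

lemma partial_y_derivative:
  fixes f :: "complex \<Rightarrow> real"
  assumes "f differentiable (at p)"
  shows "((\<lambda>h. f (p + h *\<^sub>R \<i>)) has_real_derivative partial_y f p) (at 0)"
proof -
  obtain f' where f': "(f has_derivative f') (at p)"
    using assms by (auto simp: differentiable_def)
  have "((\<lambda>h. f (p + h *\<^sub>R \<i>)) has_derivative (\<lambda>h. f' (h *\<^sub>R \<i>))) (at 0)"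
    by (rule has_derivative_compose[where g = f and x = 0]) (use f' in \<open>auto intro!: derivative_eq_intros\<close>)
  then show ?thesis
    unfolding has_field_derivative_def linear_cmul[OF has_derivative_linear[OF f']] partial_y_eq[OF f']
    by (simp add: mult_commute_abs)
qed

text \<open>Schwarz's theorem: arbitrarily near \<open>z\<close> both mixed derivatives attain a
  common value, the second difference over \<open>t\<^sup>2\<close>; by continuity they cannot
  differ at \<open>z\<close>.\<close>

lemma partial_xy_commute:
  assumes "open U" "Ck_on 2 u U" "z \<in> U"
  shows "partial_y (partial_x u) z = partial_x (partial_y u) z"
proof (rule ccontr)
  assume neq: "partial_y (partial_x u) z \<noteq> partial_x (partial_y u) z"
  \<comment> \<open>Half the gap: a number within \<open>e\<close> of both values contradicts the
    triangle inequality.\<close>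
  define e where "e = dist (partial_y (partial_x u) z) (partial_x (partial_y u) z) / 2"
  have "e > 0" using neq by (simp add: e_def)
  have diff: "p \<in> U \<Longrightarrow> u differentiable at p" "p \<in> U \<Longrightarrow> partial_x u differentiable at p"
      "p \<in> U \<Longrightarrow> partial_y u differentiable at p" for p
    using assms by (auto simp: numeral_2_eq_2 differentiable_on_def at_within_open[of _ U])
  have cont: "continuous_on U (partial_y (partial_x u))" "continuous_on U (partial_x (partial_y u))"
    using assms by (auto simp: numeral_2_eq_2)
  obtain d1 where d1: "d1 > 0" "\<And>p. p \<in> U \<Longrightarrow> dist p z < d1 \<Longrightarrow>
      dist (partial_y (partial_x u) p) (partial_y (partial_x u) z) < e"
    using cont(1) \<open>z \<in> U\<close> \<open>e > 0\<close> unfolding continuous_on_iff by meson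
  obtain d2 where d2: "d2 > 0" "\<And>p. p \<in> U \<Longrightarrow> dist p z < d2 \<Longrightarrow>
      dist (partial_x (partial_y u) p) (partial_x (partial_y u) z) < e"
    using cont(2) \<open>z \<in> U\<close> \<open>e > 0\<close> unfolding continuous_on_iff by meson
  obtain d3 where d3: "d3 > 0" "ball z d3 \<subseteq> U"
    using assms(1,3) open_contains_ball by blast
  define d where "d = min d1 (min d2 d3)"
  \<comment> \<open>Two displacements of length at most \<open>d / 3\<close> stay within distance
    \<open>d\<close> of \<open>z\<close>.\<close>
  define t where "t = d / 3"
  have "d > 0" "t > 0" using d1 d2 d3 by (auto simp: d_def t_def)
  have close: "dist (z + r *\<^sub>R a + s *\<^sub>R b) z < d"
    if "0 \<le> r" "r \<le> t" "0 \<le> s" "s \<le> t" "norm a = 1" "norm b = 1" for r s and a b :: complex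
  proof -
    have "dist (z + r *\<^sub>R a + s *\<^sub>R b) z \<le> norm (r *\<^sub>R a) + norm (s *\<^sub>R b)"
      by (metis add.assoc add_diff_cancel_left' dist_norm norm_triangle_ineq)
    then show ?thesis
      using that \<open>d > 0\<close> by (simp add: t_def)
  qed
  have inU: "z + r *\<^sub>R a + s *\<^sub>R b \<in> U"
    if "0 \<le> r" "r \<le> t" "0 \<le> s" "s \<le> t" "norm a = 1" "norm b = 1" for r s and a b :: complex
    using close[OF that] d3(2) by (auto simp: d_def dist_commute subset_iff)
  obtain r s where rs: "0 < r" "r < t" "0 < s" "s < t"
    "u (z + t *\<^sub>R 1 + t *\<^sub>R \<i>) - u (z + t *\<^sub>R 1) - u (z + t *\<^sub>R \<i>) + u z
      = t\<^sup>2 * partial_y (partial_x u) (z + r *\<^sub>R 1 + s *\<^sub>R \<i>)"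
    by (rule second_difference_mvt[where t = t and z = z and a = 1 and b = \<i> and S = U and f = u
          and fa = "partial_x u" and fab = "partial_y (partial_x u)"])
      (use \<open>t > 0\<close> diff inU in \<open>auto intro: partial_x_derivative partial_y_derivative\<close>)
  obtain r' s' where rs': "0 < r'" "r' < t" "0 < s'" "s' < t"
    "u (z + t *\<^sub>R \<i> + t *\<^sub>R 1) - u (z + t *\<^sub>R \<i>) - u (z + t *\<^sub>R 1) + u z
      = t\<^sup>2 * partial_x (partial_y u) (z + r' *\<^sub>R \<i> + s' *\<^sub>R 1)"
    by (rule second_difference_mvt[where t = t and z = z and a = \<i> and b = 1 and S = U and f = u
          and fa = "partial_y u" and fab = "partial_x (partial_y u)"])
      (use \<open>t > 0\<close> diff inU in \<open>auto intro: partial_x_derivative partial_y_derivative\<close>)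
  have "t\<^sup>2 * partial_y (partial_x u) (z + r *\<^sub>R 1 + s *\<^sub>R \<i>)
      = t\<^sup>2 * partial_x (partial_y u) (z + r' *\<^sub>R \<i> + s' *\<^sub>R 1)"
    using rs(5) rs'(5) by (simp add: add.commute add.left_commute diff_diff_eq del: mult_cancel_left)
  then have "partial_y (partial_x u) (z + r *\<^sub>R 1 + s *\<^sub>R \<i>)
      = partial_x (partial_y u) (z + r' *\<^sub>R \<i> + s' *\<^sub>R 1)"
    using \<open>t > 0\<close> by simp
  moreover have "dist (partial_y (partial_x u) (z + r *\<^sub>R 1 + s *\<^sub>R \<i>)) (partial_y (partial_x u) z) < e"
    using close[of r s 1 \<i>] inU[of r s 1 \<i>] rs by (intro d1(2)) (simp_all add: d_def)
  moreover have "dist (partial_x (partial_y u) (z + r' *\<^sub>R \<i> + s' *\<^sub>R 1)) (partial_x (partial_y u) z) < e"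
    using close[of r' s' \<i> 1] inU[of r' s' \<i> 1] rs' by (intro d2(2)) (simp_all add: d_def)
  ultimately have "dist (partial_y (partial_x u) z) (partial_x (partial_y u) z)
      < dist (partial_y (partial_x u) z) (partial_x (partial_y u) z)"
    unfolding e_def by (metis dist_triangle_half_r)
  then show False by simp
qed

section \<open>The surface tension\<close>

text \<open>With y = x / 2, the inequality y cos y \<le> sin y gives sin x = 2 sin y cos y \<ge> x
  (cos y)^2, and cos y \<ge> cos (b / 2). For b < pi the slope is positive, which controls the
  logarithm of the sine near 0.\<close>

lemma sin_ge_linear:
  fixes x b :: real
  assumes "0 \<le> x" "x \<le> b" "b \<le> pi"
  shows "(cos (b / 2))\<^sup>2 * x \<le> sin x"
proof -
  define y where "y = x / 2"
  have y: "0 \<le> y" "y \<le> b / 2" "y \<le> pi / 2" using assms by (auto simp: y_def)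
  have "sin 0 - 0 * cos 0 \<le> sin y - y * cos y"
  proof (rule DERIV_nonneg_imp_nondecreasing[OF y(1)])
    fix v assume v: "0 \<le> v" "v \<le> y"
    have "((\<lambda>v. sin v - v * cos v) has_real_derivative v * sin v) (at v)"
      by (auto intro!: derivative_eq_intros)
    moreover have "0 \<le> v * sin v"
      using v y by (auto intro!: mult_nonneg_nonneg sin_ge_zero)
    ultimately show "\<exists>D. ((\<lambda>v. sin v - v * cos v) has_real_derivative D) (at v) \<and> 0 \<le> D" by blast
  qed
  then have 1: "y * cos y \<le> sin y" by simp
  have 2: "0 \<le> cos (b / 2)" "cos (b / 2) \<le> cos y"
    using assms y by (auto intro!: cos_ge_zero cos_monotone_0_pi_le)
  have "(cos (b / 2))\<^sup>2 * x \<le> (cos y)\<^sup>2 * x"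
    using 2 assms by (intro mult_right_mono power_mono) auto
  also have "\<dots> = 2 * (y * cos y) * cos y" by (simp add: y_def power2_eq_square)
  also have "\<dots> \<le> 2 * sin y * cos y"
    using 1 2 by (intro mult_right_mono) auto
  also have "\<dots> = sin x" by (simp add: sin_double[symmetric] y_def)
  finally show ?thesis .
qed

text \<open>This is ln t \<le> t at t = y^(-1/2). The exponent exceeds -1, so the bound is
  integrable at 0.\<close>

lemma neg_ln_le_powr:
  fixes y :: real
  assumes "0 < y"
  shows "- ln y \<le> 2 * y powr (-1/2)"
proof -
  have "ln (y powr (-1/2)) \<le> y powr (-1/2)"
    using ln_le_minus_one[of "y powr (-1/2)"] assms by simp
  then show ?thesis using assms by (simp add: ln_powr)
qed

lemma set_integrable_ln_sin:
  fixes b :: real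
  assumes "0 < b" "b < pi"
  shows "set_integrable lborel {0<..<b} (\<lambda>x. ln \<bar>2 * sin x\<bar>)"
proof -
  define c where "c = (cos (b / 2))\<^sup>2"
  have "cos (b / 2) > 0" using assms by (intro cos_gt_zero_pi) auto
  then have c: "c > 0" by (simp add: c_def)
  \<comment> \<open>The majorant: \<open>ln 2\<close> splits off, and the rest is
    \<open>neg_ln_le_powr\<close> at \<open>c * x\<close>, with \<open>c\<close> the slope from
    \<open>sin_ge_linear\<close>.\<close>
  define g where "g = (\<lambda>x::real. ln 2 + 2 * c powr (-1/2) * x powr (-1/2))"
  have "(\<lambda>t. t powr (-1/2)) integrable_on {0..b}"
    by (rule integrable_on_powr_from_0) (use assms in auto)
  then have "(\<lambda>t. t powr (-1/2)) absolutely_integrable_on {0..b}"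
    by (subst absolutely_integrable_on_iff_nonneg) auto
  then have "set_integrable lborel {0..b} (\<lambda>t::real. t powr (-1/2))"
    unfolding set_integrable_def by (subst (asm) integrable_completion) auto
  then have "set_integrable lborel {0<..<b} (\<lambda>t::real. t powr (-1/2))"
    by (rule set_integrable_subset) auto
  moreover have "set_integrable lborel {0<..<b} (\<lambda>t::real. ln 2 :: real)"
    by (rule set_integrable_subset[OF borel_integrable_atLeastAtMost'[of 0 b]]) auto
  ultimately have "set_integrable lborel {0<..<b} g"
    unfolding g_def by (intro set_integral_add(1) set_integrable_mult_right) auto
  then show ?thesis
  proof (rule set_integrable_bound)
    show "set_borel_measurable lborel {0<..<b} (\<lambda>x. ln \<bar>2 * sin x\<bar>)"
      unfolding set_borel_measurable_def by measurable
    have "\<bar>ln \<bar>2 * sin x\<bar>\<bar> \<le> g x" if x: "0 < x" "x < b" for x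
    proof -
      have s: "sin x > 0" using x assms by (intro sin_gt_zero) auto
      have cs: "c * x \<le> sin x" using x assms by (auto simp: c_def intro!: sin_ge_linear)
      have "- ln (sin x) \<le> - ln (c * x)"
        using cs c x s by (subst neg_le_iff_le, subst ln_le_cancel_iff) auto
      also have "\<dots> \<le> 2 * (c * x) powr (-1/2)"
        using c x by (intro neg_ln_le_powr) auto
      also have "\<dots> = 2 * c powr (-1/2) * x powr (-1/2)"
        using c x by (simp add: powr_mult)
      finally have l: "- ln (sin x) \<le> 2 * c powr (-1/2) * x powr (-1/2)" .
      have "ln (sin x) \<le> 0" using s by simp
      moreover have "ln \<bar>2 * sin x\<bar> = ln 2 + ln (sin x)"
        using s by (simp add: ln_mult)
      moreover have "ln (2::real) \<ge> 0" by simp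
      ultimately show ?thesis using l unfolding g_def abs_le_iff by linarith
    qed
    then show "AE x in lborel. x \<in> {0<..<b} \<longrightarrow> norm (ln \<bar>2 * sin x\<bar>) \<le> norm (g x)"
      by (intro AE_I2) fastforce
  qed
qed

text \<open>The integrand is singular at 0, so the fundamental theorem of calculus is applied from
  an inner point \<open>a\<close>; the integral from 0 to \<open>a\<close> is a constant.\<close>

lemma Lobachevsky_derivative:
  assumes "0 < \<theta>" "\<theta> < pi"
  shows "(Lobachevsky has_real_derivative - ln (2 * sin \<theta>)) (at \<theta>)"
proof -
  obtain a b where ab: "0 < a" "a < \<theta>" "\<theta> < b" "b < pi"
    using assms dense by metis
  let ?f = "\<lambda>x::real. ln \<bar>2 * sin x\<bar>"
  have sin: "sin x > 0" if "x \<in> {a..b}" for x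
    using ab that by (intro sin_gt_zero) auto
  have "continuous_on {a..b} ?f"
    by (intro continuous_intros) (use sin in fastforce)
  then have "((\<lambda>u. LBINT y=a..u. ?f y) has_vector_derivative ?f \<theta>) (at \<theta> within {a..b})"
    using ab by (intro interval_integral_FTC2) auto
  then have "((\<lambda>u. LBINT y=a..u. ?f y) has_vector_derivative ?f \<theta>) (at \<theta>)"
    using ab at_within_Icc_at[of a \<theta> b] by simp
  then have "((\<lambda>u. - ((LBINT y=ereal 0..ereal a. ?f y) + (LBINT y=a..u. ?f y)))
      has_real_derivative - ln (2 * sin \<theta>)) (at \<theta>)"
    using sin[of \<theta>] ab
    by (auto simp: has_real_derivative_iff_has_vector_derivative intro!: derivative_eq_intros)
  then show ?thesis
  proof (rule has_field_derivative_transform_within_open)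
    show "open {a<..<b}" "\<theta> \<in> {a<..<b}" using ab by auto
    fix u assume "u \<in> {a<..<b}"
    then have u: "a < u" "u < b" by auto
    \<comment> \<open>Integrability down to 0 permits splitting the integral at
      \<open>a\<close>.\<close>
    have "interval_lebesgue_integrable lborel (min (ereal 0) (min (ereal a) (ereal u)))
        (max (ereal 0) (max (ereal a) (ereal u))) ?f"
      using set_integrable_ln_sin[of u] ab u
      by (simp add: interval_lebesgue_integrable_def min_def max_def)
    from interval_integral_sum[OF this]
    show "- ((LBINT y=ereal 0..ereal a. ?f y) + (LBINT y=a..u. ?f y)) = Lobachevsky u"
      by (simp add: Lobachevsky_def)
  qed
qed

section \<open>The open triangle and the gradient of the surface tension\<close>

definition open_triangle :: "complex set" where
  "open_triangle = {p. 0 < Re p \<and> 0 < Im p \<and> Re p + Im p < 1}"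

lemma open_triangleI:
  assumes "p \<in> interior triangle_N"
  shows "p \<in> open_triangle"
proof -
  let ?T = "{p. 0 \<le> Re p \<and> 0 \<le> Im p \<and> Re p + Im p \<le> 1}"
  have "convex ?T"
  proof (rule convexI)
    fix x y :: complex and u v :: real
    assume *: "x \<in> ?T" "y \<in> ?T" "0 \<le> u" "0 \<le> v" "u + v = 1"
    then have "u * (Re x + Im x) + v * (Re y + Im y) \<le> 1"
      by (intro convex_bound_le) auto
    with * show "u *\<^sub>R x + v *\<^sub>R y \<in> ?T"
      by (auto simp: algebra_simps)
  qed
  then have sub: "triangle_N \<subseteq> ?T"
    unfolding triangle_N_def by (intro hull_minimal) auto
  obtain e where e: "e > 0" "cball p e \<subseteq> triangle_N"
    using assms mem_interior_cball by blast
  have T: "p + h \<in> ?T" if "norm h \<le> e" for h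
  proof -
    have "p + h \<in> cball p e" using that by (simp add: dist_norm)
    then show ?thesis using e(2) sub by blast
  qed
  \<comment> \<open>Moving \<open>p\<close> by \<open>e\<close> to the left, down and to the right
    gives each of the three inequalities with slack \<open>e\<close>.\<close>
  show ?thesis
    using T[of "- of_real e"] T[of "- \<i> * of_real e"] T[of "of_real e"] e(1)
    by (auto simp: open_triangle_def norm_mult)
qed

lemma sin_pi_pos: "0 < s \<Longrightarrow> s < 1 \<Longrightarrow> 0 < sin (pi * s)"
  by (intro sin_gt_zero) auto

lemma open_triangle_sin_pos:
  assumes "p \<in> open_triangle"
  shows "0 < sin (pi * Re p)" "0 < sin (pi * Im p)" "0 < sin (pi * (Re p + Im p))"
  using assms by (auto simp: open_triangle_def intro!: sin_pi_pos)

text \<open>Each Lobachevsky term contributes a logarithm of twice a sine. The third argument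
  decreases in both variables, so its logarithm enters with the opposite sign and the summands
  \<open>ln 2\<close> cancel.\<close>

lemma gradient_surface_tension:
  assumes "p \<in> open_triangle"
  shows "gradient surface_tension p =
    Complex ((ln (sin (pi * Re p)) - ln (sin (pi * (Re p + Im p)))) / pi)
            ((ln (sin (pi * Im p)) - ln (sin (pi * (Re p + Im p)))) / pi)"
proof -
  have L: "((\<lambda>x. Lobachevsky (g x)) has_real_derivative - ln (2 * sin (g x)) * g') (at x)"
    if "(g has_real_derivative g') (at x)" "0 < g x" "g x < pi" for g g' x
    using DERIV_chain2[OF Lobachevsky_derivative that(1)] that by simp
  have sin: "sin (pi * (1 - Re p - Im p)) = sin (pi * (Re p + Im p))"
    by (simp add: sin_diff cos_diff sin_add cos_add algebra_simps)
  note pos = open_triangle_sin_pos[OF assms]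
  have p: "0 < Re p" "0 < Im p" "Re p + Im p < 1"
    using assms by (auto simp: open_triangle_def)
  have b: "0 < pi * Re p" "0 < pi * Im p" "0 < pi * (1 - Re p - Im p)"
      "pi * Re p < pi" "pi * Im p < pi" "pi * (1 - Re p - Im p) < pi"
    using p by auto
  \<comment> \<open>The derivative is kept summand by summand; the \<open>0\<close> belongs to the
    term in \<open>Im p\<close>, which is constant in this direction.\<close>
  have "((\<lambda>h. surface_tension (p + of_real h)) has_real_derivative
      - (1 / pi\<^sup>2) * (- ln (2 * sin (pi * Re p)) * pi + 0
        + - ln (2 * sin (pi * (1 - Re p - Im p))) * - pi)) (at 0)"
    unfolding surface_tension_def
    by (rule DERIV_cmult DERIV_add)+
      (use b in \<open>auto intro!: derivative_eq_intros L[THEN DERIV_cong]\<close>)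
  moreover have "- (1 / pi\<^sup>2) * (- ln (2 * sin (pi * Re p)) * pi + 0
        + - ln (2 * sin (pi * (1 - Re p - Im p))) * - pi)
      = (ln (sin (pi * Re p)) - ln (sin (pi * (Re p + Im p)))) / pi"
    using pos by (simp add: sin ln_mult field_simps power2_eq_square)
  ultimately have x: "partial_x surface_tension p
      = (ln (sin (pi * Re p)) - ln (sin (pi * (Re p + Im p)))) / pi"
    unfolding partial_x_def
    by (metis has_real_derivative_iff_has_vector_derivative vector_derivative_at)
  have "((\<lambda>h. surface_tension (p + \<i> * of_real h)) has_real_derivative
      - (1 / pi\<^sup>2) * (0 + - ln (2 * sin (pi * Im p)) * pi
        + - ln (2 * sin (pi * (1 - Re p - Im p))) * - pi)) (at 0)"
    unfolding surface_tension_def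
    by (rule DERIV_cmult DERIV_add)+
      (use b in \<open>auto intro!: derivative_eq_intros L[THEN DERIV_cong]\<close>)
  moreover have "- (1 / pi\<^sup>2) * (0 + - ln (2 * sin (pi * Im p)) * pi
        + - ln (2 * sin (pi * (1 - Re p - Im p))) * - pi)
      = (ln (sin (pi * Im p)) - ln (sin (pi * (Re p + Im p)))) / pi"
    using pos by (simp add: sin ln_mult field_simps power2_eq_square)
  ultimately have y: "partial_y surface_tension p
      = (ln (sin (pi * Im p)) - ln (sin (pi * (Re p + Im p)))) / pi"
    unfolding partial_y_def
    by (metis has_real_derivative_iff_has_vector_derivative vector_derivative_at)
  show ?thesis by (simp add: gradient_def x y)
qed

section \<open>The Hessian of the surface tension\<close>

definition sigma_ss :: "complex \<Rightarrow> real" where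
  "sigma_ss p = cot (pi * Re p) - cot (pi * (Re p + Im p))"

definition sigma_st :: "complex \<Rightarrow> real" where
  "sigma_st p = - cot (pi * (Re p + Im p))"

definition sigma_tt :: "complex \<Rightarrow> real" where
  "sigma_tt p = cot (pi * Im p) - cot (pi * (Re p + Im p))"

definition hessian_sigma :: "complex \<Rightarrow> complex \<Rightarrow> complex" where
  "hessian_sigma p h = Complex (sigma_ss p * Re h + sigma_st p * Im h)
                               (sigma_st p * Re h + sigma_tt p * Im h)"

text \<open>The determinant expands to cot a cot b - cot (a + b) (cot a + cot b), which is 1 by the
  addition theorem.\<close>

lemma hessian_sigma_det:
  assumes "p \<in> open_triangle"
  shows "sigma_ss p * sigma_tt p - (sigma_st p)\<^sup>2 = 1"
proof -
  define a b where "a = pi * Re p" and "b = pi * Im p"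
  have s: "sin a > 0" "sin b > 0" "sin (a + b) > 0"
    using open_triangle_sin_pos[OF assms] by (auto simp: a_def b_def algebra_simps)
  have c: "cot a = cos a / sin a" "cot b = cos b / sin b"
      "cot (a + b) = cos (a + b) / sin (a + b)" by (simp_all add: cot_def)
  have "cot a + cot b = sin (a + b) / (sin a * sin b)"
    using s by (simp add: c sin_add field_simps)
  then have "cot (a + b) * (cot a + cot b) = cos (a + b) / (sin a * sin b)"
    using s by (simp add: c(3))
  also have "\<dots> = cot a * cot b - 1"
    using s by (simp add: c(1,2) cos_add field_simps)
  finally show ?thesis
    by (simp add: sigma_ss_def sigma_st_def sigma_tt_def distrib_left flip: a_def b_def)
      (simp add: algebra_simps power2_eq_square)
qed

lemma sigma_ss_pos:
  assumes "p \<in> open_triangle"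
  shows "0 < sigma_ss p"
proof -
  define a b where "a = pi * Re p" and "b = pi * Im p"
  have s: "sin a > 0" "sin b > 0" "sin (a + b) > 0"
    using open_triangle_sin_pos[OF assms] by (auto simp: a_def b_def algebra_simps)
  have "sin ((a + b) - a) = sin (a + b) * cos a - cos (a + b) * sin a"
    by (rule sin_diff)
  then have "cot a - cot (a + b) = sin b / (sin a * sin (a + b))"
    using s by (simp add: cot_def field_simps)
  also have "\<dots> > 0" using s by simp
  finally show ?thesis
    by (simp add: sigma_ss_def distrib_left flip: a_def b_def)
qed

text \<open>Determinant 1 forces the diagonal entries to have the same sign. Hence
  \<open>2 + sigma_ss p + sigma_tt p\<close>, the determinant of I + A for the Hessian A, is
  positive and may serve as a denominator.\<close>

lemma hessian_sigma_trace_pos: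
  assumes "p \<in> open_triangle"
  shows "0 < sigma_ss p + sigma_tt p"
proof -
  have "0 < sigma_ss p * sigma_tt p"
    using hessian_sigma_det[OF assms] by (smt (verit) zero_le_power2)
  then have "0 < sigma_tt p"
    using sigma_ss_pos[OF assms] by (simp add: zero_less_mult_iff)
  then show ?thesis using sigma_ss_pos[OF assms] by simp
qed

text \<open>Multiply by the positive \<open>sigma_ss p\<close> and complete the square; the
  remaining coefficient is the determinant.\<close>

lemma hessian_sigma_nonneg:
  assumes "p \<in> open_triangle"
  shows "0 \<le> h \<bullet> hessian_sigma p h"
proof -
  have "sigma_ss p * (h \<bullet> hessian_sigma p h)
      = (sigma_ss p * Re h + sigma_st p * Im h)\<^sup>2 + (sigma_ss p * sigma_tt p - (sigma_st p)\<^sup>2) * (Im h)\<^sup>2"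
    by (simp add: hessian_sigma_def inner_complex_def algebra_simps power2_eq_square)
  also have "\<dots> \<ge> 0" by (simp add: hessian_sigma_det[OF assms])
  finally show ?thesis
    using sigma_ss_pos[OF assms] by (simp add: zero_le_mult_iff)
qed

lemma open_open_triangle: "open open_triangle"
  unfolding open_triangle_def
  by (intro open_Collect_conj open_Collect_less continuous_intros)

lemma gradient_surface_tension_derivative:
  assumes "p \<in> open_triangle"
  shows "(gradient surface_tension has_derivative hessian_sigma p) (at p)"
proof -
  note pos = open_triangle_sin_pos[OF assms]
  have "((\<lambda>p. Complex ((ln (sin (pi * Re p)) - ln (sin (pi * (Re p + Im p)))) / pi)
            ((ln (sin (pi * Im p)) - ln (sin (pi * (Re p + Im p)))) / pi))
      has_derivative hessian_sigma p) (at p)"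
    unfolding hessian_sigma_def
    by (rule has_derivative_Complex; (rule derivative_eq_intros refl pos)+;
        use pos in \<open>auto simp: sigma_ss_def sigma_st_def sigma_tt_def cot_def fun_eq_iff field_simps\<close>)
  then show ?thesis
    by (rule has_derivative_transform_within_open[OF _ open_open_triangle assms])
      (simp add: gradient_surface_tension)
qed

section \<open>The inverse of I + grad sigma and the derivative of \<open>H_sigma\<close>\<close>

lemma I_plus_grad_derivative:
  assumes "p \<in> open_triangle"
  shows "(I_plus_grad has_derivative (\<lambda>h. h + hessian_sigma p h)) (at p)"
  unfolding I_plus_grad_def
  by (intro has_derivative_add has_derivative_ident gradient_surface_tension_derivative assms)

lemma I_minus_grad_derivative:
  assumes "p \<in> open_triangle"
  shows "(I_minus_grad has_derivative (\<lambda>h. h - hessian_sigma p h)) (at p)"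
  unfolding I_minus_grad_def
  by (intro has_derivative_diff has_derivative_ident gradient_surface_tension_derivative assms)

text \<open>By convexity of the surface tension, \<^term>\<open>I_plus_grad\<close> is strictly monotone along segments.\<close>

lemma inj_on_I_plus_grad: "inj_on I_plus_grad (interior triangle_N)"
proof (rule inj_onI, rule ccontr)
  fix p q assume p: "p \<in> interior triangle_N" and q: "q \<in> interior triangle_N"
    and eq: "I_plus_grad p = I_plus_grad q" and "p \<noteq> q"
  define d where "d = p - q"
  define \<gamma> where "\<gamma> = (\<lambda>t::real. q + t *\<^sub>R d)"
  have \<gamma>: "\<gamma> t \<in> open_triangle" if "0 \<le> t" "t \<le> 1" for t
  proof -
    have "convex (interior triangle_N)"
      by (auto simp: triangle_N_def intro: convex_interior convex_convex_hull)
    from convexD_alt[OF this q p that] show ?thesis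
      by (intro open_triangleI) (simp add: \<gamma>_def d_def algebra_simps)
  qed
  have "((\<lambda>t. d \<bullet> I_plus_grad (\<gamma> t)) has_real_derivative d \<bullet> (d + hessian_sigma (\<gamma> t) d)) (at t)"
    if "0 \<le> t" "t \<le> 1" for t
  proof -
    have "(\<gamma> has_vector_derivative d) (at t)"
      by (auto simp: \<gamma>_def intro!: derivative_eq_intros)
    from vector_derivative_diff_chain_within[OF this, of I_plus_grad]
    have "((I_plus_grad \<circ> \<gamma>) has_vector_derivative d + hessian_sigma (\<gamma> t) d) (at t)"
      using I_plus_grad_derivative[OF \<gamma>[OF that]] has_derivative_at_withinI by blast
    from bounded_linear.has_vector_derivative[OF bounded_linear_inner_right this]
    show ?thesis
      by (simp add: has_real_derivative_iff_has_vector_derivative)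
  qed
  from MVT2[of 0 1, OF _ this] obtain t where t: "0 < t" "t < 1"
    "d \<bullet> I_plus_grad (\<gamma> 1) - d \<bullet> I_plus_grad (\<gamma> 0) = d \<bullet> (d + hessian_sigma (\<gamma> t) d)"
    by auto
  \<comment> \<open>\<open>I_plus_grad\<close> agrees at the endpoints \<open>q\<close> and
    \<open>p\<close> of \<open>\<gamma>\<close>, so the derivative found by the mean value theorem
    vanishes.\<close>
  have "d \<bullet> d + d \<bullet> hessian_sigma (\<gamma> t) d = 0"
    using t(3) eq by (simp add: \<gamma>_def d_def inner_add_right)
  moreover have "d \<bullet> d > 0" using \<open>p \<noteq> q\<close> by (simp add: d_def)
  ultimately show False
    using hessian_sigma_nonneg[OF \<gamma>, of t d] t(1,2) by linarith
qed

text \<open>Since \<^prop>\<open>det A = 1\<close> for the Hessian \<open>A\<close>, Cayley--Hamilton gives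
  \<open>(I - A) (I + A)\<^sup>-\<^sup>1 = (adj A - A) / (2 + tr A)\<close>, a symmetric traceless matrix: it is
  a complex multiple of conjugation.\<close>

definition H_sigma_deriv :: "complex \<Rightarrow> complex" where
  "H_sigma_deriv p = Complex (sigma_tt p - sigma_ss p) (- 2 * sigma_st p)
     / of_real (2 + sigma_ss p + sigma_tt p)"

text \<open>The symmetric traceless matrix with first row (x, y) acts as h \<mapsto> (x + iy)
  \<open>cnj h\<close>; here (x, y) is the first row of (adj A - A) / (2 + tr A).\<close>

lemma I_minus_hessian:
  assumes "p \<in> open_triangle"
  shows "h - hessian_sigma p h = H_sigma_deriv p * cnj (h + hessian_sigma p h)"
proof -
  define D where "D = 2 + sigma_ss p + sigma_tt p"
  have "D > 0" using hessian_sigma_trace_pos[OF assms] by (simp add: D_def)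
  \<comment> \<open>With the denominator cleared, both coordinates are polynomial identities in the
    Hessian entries modulo determinant 1.\<close>
  have "of_real D * (h - hessian_sigma p h)
      = Complex (sigma_tt p - sigma_ss p) (- 2 * sigma_st p) * cnj (h + hessian_sigma p h)"
    using hessian_sigma_det[OF assms]
    unfolding complex_eq_iff D_def hessian_sigma_def
    by (simp, intro conjI; algebra)
  then have "h - hessian_sigma p h = Complex (sigma_tt p - sigma_ss p) (- 2 * sigma_st p)
      * cnj (h + hessian_sigma p h) / of_real D"
    using \<open>D > 0\<close> by (subst nonzero_eq_divide_eq) (simp_all add: mult.commute)
  then show ?thesis
    unfolding H_sigma_deriv_def D_def[symmetric] by (simp only: times_divide_eq_left)
qed

text \<open>The inverse function theorem and the chain rule give (I - A) (I + A)^(-1) applied to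
  \<open>cnj h\<close>. By \<open>I_minus_hessian\<close> this conjugates once more, so the
  derivative is multiplication by a complex number: \<open>H_sigma\<close> is holomorphic.\<close>

lemma H_sigma_derivative:
  assumes p: "p \<in> interior triangle_N"
  shows "(H_sigma has_derivative (*) (H_sigma_deriv p)) (at (cnj (I_plus_grad p)))"
proof -
  define D where "D = 2 + sigma_ss p + sigma_tt p"
  \<comment> \<open>\<open>B\<close> is (I + A)^(-1) by Cramer's rule: the adjugate of I + A over
    its determinant 1 + tr A + det A = \<open>D\<close>.\<close>
  define B where "B = (\<lambda>k. Complex ((1 + sigma_tt p) * Re k - sigma_st p * Im k)
      ((1 + sigma_ss p) * Im k - sigma_st p * Re k) /\<^sub>R D)"
  have pT: "p \<in> open_triangle" by (rule open_triangleI[OF p])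
  have "D > 0" using hessian_sigma_trace_pos[OF pT] by (simp add: D_def)
  have B: "B k + hessian_sigma p (B k) = k" for k
  proof -
    have "D *\<^sub>R (B k + hessian_sigma p (B k)) = D *\<^sub>R B k + hessian_sigma p (D *\<^sub>R B k)"
      by (simp add: hessian_sigma_def complex_eq_iff algebra_simps)
    also have "D *\<^sub>R B k = Complex ((1 + sigma_tt p) * Re k - sigma_st p * Im k)
      ((1 + sigma_ss p) * Im k - sigma_st p * Re k)"
      using \<open>D > 0\<close> by (simp add: B_def)
    also have "\<dots> + hessian_sigma p \<dots> = D *\<^sub>R k"
      using hessian_sigma_det[OF pT]
      unfolding complex_eq_iff D_def hessian_sigma_def
      by (intro conjI; simp; algebra)
    finally show ?thesis using \<open>D > 0\<close> by simp
  qed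
  let ?g = "inv_into (interior triangle_N) I_plus_grad"
  have "(?g has_derivative B) (at (I_plus_grad p))"
  proof (rule has_derivative_inverse_strong[where f = I_plus_grad and S = "interior triangle_N"])
    show "continuous_on (interior triangle_N) I_plus_grad"
      by (rule has_derivative_continuous_on)
        (rule has_derivative_at_withinI[OF I_plus_grad_derivative[OF open_triangleI]])
    show "(\<lambda>h. h + hessian_sigma p h) \<circ> B = id" using B by auto
  qed (use p pT in \<open>auto intro: I_plus_grad_derivative inv_into_f_f inj_on_I_plus_grad\<close>)
  \<comment> \<open>The base point is written as \<open>cnj\<close> of the point where
    \<open>H_sigma\<close> is differentiated, to fit the chain rule.\<close>
  then have g: "(?g has_derivative B) (at (cnj (cnj (I_plus_grad p))))" by simp
  have "((\<lambda>z. ?g (cnj z)) has_derivative (\<lambda>h. B (cnj h))) (at (cnj (I_plus_grad p)))"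
    by (rule has_derivative_compose[where f = cnj, OF _ g]) (auto intro!: derivative_eq_intros)
  moreover have "(I_minus_grad has_derivative (\<lambda>h. h - hessian_sigma p h))
      (at (?g (cnj (cnj (I_plus_grad p)))))"
    using I_minus_grad_derivative[OF pT] p inj_on_I_plus_grad by simp
  ultimately have "((\<lambda>z. I_minus_grad (?g (cnj z))) has_derivative
      (\<lambda>h. B (cnj h) - hessian_sigma p (B (cnj h)))) (at (cnj (I_plus_grad p)))"
    by (rule has_derivative_compose[where f = "\<lambda>z. ?g (cnj z)" and f' = "\<lambda>h. B (cnj h)"])
  then show ?thesis
    by (simp add: H_sigma_def[abs_def] I_minus_hessian[OF pT] B)
qed

section \<open>The Beltrami equation\<close>

theorem theorem5p1:
  fixes U :: "complex set" and u :: "complex \<Rightarrow> real" and S q \<kappa> :: complex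
    and f :: "complex \<Rightarrow> complex"
  assumes "open U"
    and "q \<noteq> 0"
    and "\<forall>z\<in>U. w_exponential S q \<kappa> z - 1 \<noteq> 0"
    and "\<forall>z\<in>U. w_source S q \<kappa> z \<in> \<real>"
    and "smooth_on u U"
    and "gradient u ` U \<subseteq> interior triangle_N"
    and "\<forall>z\<in>U. of_real (divergence (\<lambda>p. gradient surface_tension (gradient u p)) z)
               = w_source S q \<kappa> z"
    and "f = (\<lambda>z. cnj (I_plus_grad (gradient u z)))"
  shows "\<forall>z\<in>U. wirtinger_zbar f z
               = wirtinger_z H_sigma (f z) * wirtinger_z f z + w_source S q \<kappa> z"
proof
  fix z assume z: "z \<in> U"
  have C2: "Ck_on 2 u U" using assms(5) by (simp add: smooth_on_def)
  then have "partial_x u differentiable at z" "partial_y u differentiable at z"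
    using z assms(1) by (auto simp: numeral_2_eq_2 differentiable_on_def at_within_open[of _ U])
  then obtain Dx Dy where D: "(partial_x u has_derivative Dx) (at z)"
      "(partial_y u has_derivative Dy) (at z)"
    by (auto simp: differentiable_def)
  define p where "p = gradient u z"
  \<comment> \<open>\<open>a\<close> and \<open>b\<close> are the x- and y-derivatives of the
    gradient of \<open>u\<close>; \<open>A a\<close> and \<open>A b\<close> are then those of grad
    sigma along it.\<close>
  define a where "a = Complex (Dx 1) (Dy 1)"
  define b where "b = Complex (Dx \<i>) (Dy \<i>)"
  define C where "C = H_sigma_deriv p"
  define A where "A = hessian_sigma p"
  have p: "p \<in> interior triangle_N" "p \<in> open_triangle"
    using assms(6) z by (auto simp: p_def intro: open_triangleI)
  have sym: "Im a = Re b"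
    using partial_xy_commute[OF assms(1) C2 z]
    by (simp add: a_def b_def partial_x_eq[OF D(2)] partial_y_eq[OF D(1)])
  have grad: "(gradient u has_derivative (\<lambda>h. Complex (Dx h) (Dy h))) (at z)"
    unfolding gradient_def by (intro has_derivative_Complex D)
  have g: "((\<lambda>z. gradient surface_tension (gradient u z)) has_derivative
      (\<lambda>h. A (Complex (Dx h) (Dy h)))) (at z)"
    using has_derivative_compose[OF grad] gradient_surface_tension_derivative p(2)
    unfolding A_def p_def by blast
  have "divergence (\<lambda>p. gradient surface_tension (gradient u p)) z = Re (A a) + Im (A b)"
    unfolding divergence_def a_def b_def
    by (intro arg_cong2[where f = "(+)"] partial_x_eq[where f' = "\<lambda>h. Re (A (Complex (Dx h) (Dy h)))"]
        partial_y_eq[where f' = "\<lambda>h. Im (A (Complex (Dx h) (Dy h)))"])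
      (auto intro: bounded_linear.has_derivative[OF bounded_linear_Re g]
        bounded_linear.has_derivative[OF bounded_linear_Im g])
  then have w: "w_source S q \<kappa> z = of_real (Re (A a) + Im (A b))"
    using assms(7) z by metis
  have f': "(f has_derivative (\<lambda>h. cnj (Complex (Dx h) (Dy h) + A (Complex (Dx h) (Dy h))))) (at z)"
    unfolding assms(8) I_plus_grad_def
    by (intro bounded_linear.has_derivative[OF bounded_linear_cnj] has_derivative_add grad g)
  have fx: "partial_x f z = cnj (a + A a)" and fy: "partial_y f z = cnj (b + A b)"
    using partial_x_eq[OF f'] partial_y_eq[OF f'] by (simp_all add: a_def b_def)
  have H: "(H_sigma has_derivative (*) C) (at (f z))"
    using H_sigma_derivative[OF p(1)] by (simp add: assms(8) p_def C_def)
  \<comment> \<open>The partial derivatives are \<open>C\<close> and \<open>C * \<i>\<close>, so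
    half of C - i (C i) is \<open>C\<close>.\<close>
  have Hz: "wirtinger_z H_sigma (f z) = C"
    by (simp add: wirtinger_z_def partial_x_eq[OF H] partial_y_eq[OF H] complex_eq_iff)
  have "wirtinger_z H_sigma (f z) * wirtinger_z f z = (C * cnj (a + A a) - \<i> * (C * cnj (b + A b))) / 2"
    unfolding Hz by (simp add: wirtinger_z_def fx fy algebra_simps)
  also have "\<dots> = ((a - A a) - \<i> * (b - A b)) / 2"
    using I_minus_hessian[OF p(2)] by (simp add: A_def C_def)
  \<comment> \<open>The real parts agree because \<open>w\<close> supplies
    \<open>Re (A a) + Im (A b)\<close>; the imaginary parts differ by \<open>Re b - Im a\<close>,
    which is 0 by \<open>sym\<close>.\<close>
  finally show "wirtinger_zbar f z = wirtinger_z H_sigma (f z) * wirtinger_z f z + w_source S q \<kappa> z"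
    using sym by (simp add: w wirtinger_zbar_def fx fy complex_eq_iff field_simps)
qed

end
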